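(* Let $G$ be a totally disconnected locally compact group and $\phi:G\to G$ a topological automorphism. Then $$\log s(\phi)\leq h_{top}(\phi).$$
   Context: Let $G$ be a totally disconnected locally compact group. $\mathcal B(G)$ denotes the family of all compact open subgroups of $G$ (a local base at the identity by van Dantzig's theorem). A topological automorphism is a group automorphism that is also a homeomorphism. Scale: for $U\in\mathcal B(G)$ put $s(\phi,U)=[\phi(U):U\cap\phi(U)]$ (a finite index) and $s(\phi)=\min\{s(\phi,U):U\in\mathcal B(G)\}$. Topological entropy: for $U\in\mathcal B(G)$ and $n\ge 0$ put $U_{-n}=\bigcap_{k=-n}^0\phi^k(U)$, let $H_{top}(\phi,U)=\lim_{n\to\infty}\frac{\log[U:U_{-n}]}{n}$ (the limit exists), and $h_{top}(\phi)=\sup\{H_{top}(\phi,U):U\in\mathcal B(G)\}\in[0,\infty]$. *)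

theory Defs
  imports "HOL-Analysis.Analysis" "HOL-Algebra.Coset"
begin

locale topological_group = group G for G (structure) +
  fixes T :: "'a topology"
  assumes topspace_eq_carrier: "topspace T = carrier G"
    and continuous_map_mult: "continuous_map (prod_topology T T) T (\<lambda>(x, y). x \<otimes> y)"
    and continuous_map_inv: "continuous_map T T (\<lambda>x. inv\<^bsub>G\<^esub> x)"

(* No separation axiom is listed: a totally disconnected topological group is T1, hence Hausdorff. *)
locale tdlc_group = topological_group +
  assumes locally_compact: "locally_compact_space T"
    and totally_disconnected: "\<And>x. x \<in> carrier G \<Longrightarrow> connected_component_of_set T x = {x}"

definition topological_automorphism ::
    "('a, 'b) monoid_scheme \<Rightarrow> 'a topology \<Rightarrow> ('a \<Rightarrow> 'a) \<Rightarrow> bool" where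
  "topological_automorphism G T \<phi> \<longleftrightarrow> \<phi> \<in> iso G G \<and> homeomorphic_map T T \<phi>"

definition compact_open_subgroups ::
    "('a, 'b) monoid_scheme \<Rightarrow> 'a topology \<Rightarrow> 'a set set" where
  "compact_open_subgroups G T = {U. subgroup U G \<and> compactin T U \<and> openin T U}"

(* The index [H : K] of a subgroup K of G contained in the subgroup H of G. An infinite index
   would give 0, but an open subgroup of a compact group has finite index. *)
definition subgroup_index ::
    "('a, 'b) monoid_scheme \<Rightarrow> 'a set \<Rightarrow> 'a set \<Rightarrow> nat" where
  "subgroup_index G H K = card (rcosets\<^bsub>G\<lparr>carrier := H\<rparr>\<^esub> K)"

definition scale_at ::
    "('a, 'b) monoid_scheme \<Rightarrow> ('a \<Rightarrow> 'a) \<Rightarrow> 'a set \<Rightarrow> nat" where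
  "scale_at G \<phi> U = subgroup_index G (\<phi> ` U) (U \<inter> \<phi> ` U)"

(* An infimum of naturals over a nonempty family (van Dantzig), hence a minimum. *)
definition scale ::
    "('a, 'b) monoid_scheme \<Rightarrow> 'a topology \<Rightarrow> ('a \<Rightarrow> 'a) \<Rightarrow> nat" where
  "scale G T \<phi> = (INF U \<in> compact_open_subgroups G T. scale_at G \<phi> U)"

(* The k-th iterate on carrier G of a bijection of carrier G, for any integer k. *)
definition iterate ::
    "('a, 'b) monoid_scheme \<Rightarrow> ('a \<Rightarrow> 'a) \<Rightarrow> int \<Rightarrow> 'a \<Rightarrow> 'a" where
  "iterate G \<phi> k =
    (if k \<ge> 0 then \<phi> ^^ nat k else inv_into (carrier G) \<phi> ^^ nat (- k))"

(* cotrajectory G phi U n is the subgroup usually written U_{-n}. *)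
definition cotrajectory ::
    "('a, 'b) monoid_scheme \<Rightarrow> ('a \<Rightarrow> 'a) \<Rightarrow> 'a set \<Rightarrow> nat \<Rightarrow> 'a set" where
  "cotrajectory G \<phi> U n = (\<Inter>k\<in>{- int n..0}. iterate G \<phi> k ` U)"

definition H_top ::
    "('a, 'b) monoid_scheme \<Rightarrow> ('a \<Rightarrow> 'a) \<Rightarrow> 'a set \<Rightarrow> real" where
  "H_top G \<phi> U = lim (\<lambda>n. ln (real (subgroup_index G U (cotrajectory G \<phi> U n))) / real n)"

definition h_top ::
    "('a, 'b) monoid_scheme \<Rightarrow> 'a topology \<Rightarrow> ('a \<Rightarrow> 'a) \<Rightarrow> ereal" where
  "h_top G T \<phi> = (SUP U \<in> compact_open_subgroups G T. ereal (H_top G \<phi> U))"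

end

theory Submission
  imports Defs "HOL-Real_Asymp.Real_Asymp"
begin

text \<open>
  Fix a compact open subgroup \<open>U\<close>, write \<open>V n\<close> for the intersection of
  \<open>U, \<phi>\<^sup>-\<^sup>1 U, \<dots>, \<phi>\<^sup>-\<^sup>n U\<close>, and let \<open>\<alpha> n = [V n : V (n+1)]\<close>. Everything rests on the identity
  \<open>\<phi> (V (n+1)) = V n \<inter> \<phi> (V n)\<close>. Applying the automorphism \<open>\<phi>\<close> to the index \<open>\<alpha> n\<close> turns it into
  \<open>[\<phi> (V n) : V n \<inter> \<phi> (V n)]\<close>, the scale of \<open>\<phi>\<close> at the compact open subgroup \<open>V n\<close>. So every
  \<open>\<alpha> n\<close> is at least the scale of \<open>\<phi>\<close> (\<open>scale_le_step_index\<close>).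

  Intersecting with a subgroup does not increase an index, so the same identity shows that \<open>\<alpha>\<close>
  is nonincreasing (\<open>step_index_Suc_le\<close>). A nonincreasing sequence of positive integers
  is eventually a constant \<open>c\<close>, and by multiplicativity of the index
  \<open>[U : V n]\<close> grows in the end by a factor \<open>c\<close> in each step. Hence the limit
  defining the entropy at \<open>U\<close> exists and equals \<open>ln c\<close>, which is at least the logarithm of the scale
  (\<open>ln_scale_le_H_top\<close>). The inequality thus holds at every single \<open>U\<close>.

  What remains is that there is at least one compact open subgroup, as the supremum over the
  empty family would be \<open>-\<infinity>\<close>. This is van Dantzig's theorem (\<open>van_Dantzig\<close>): total disconnectedness
  yields a compact clopen neighbourhood \<open>C\<close> of the identity, and the elements whose right
  translation preserves \<open>C\<close> form a compact open subgroup inside \<open>C\<close>.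
\<close>

section \<open>Indices of subgroups\<close>

context group
begin

lemma subgroup_index_eq_card_image:
  "subgroup_index G H K = card ((\<lambda>x. K #> x) ` H)"
proof -
  have "rcosets\<^bsub>G\<lparr>carrier := H\<rparr>\<^esub> K = (\<lambda>x. K #> x) ` H"
    by (auto simp: RCOSETS_def r_coset_def)
  then show ?thesis
    by (simp add: subgroup_index_def)
qed

lemma r_coset_subset_subgroup:
  assumes "subgroup H G" "K \<subseteq> H" "x \<in> H"
  shows "K #> x \<subseteq> H"
  using assms by (auto simp: r_coset_def intro: subgroup.m_closed)

lemma r_coset_mono: "A \<subseteq> B \<Longrightarrow> A #> x \<subseteq> B #> x"
  by (auto simp: r_coset_def)

lemma r_coset_eqI:
  assumes "subgroup K G" "x \<in> carrier G" "y \<in> carrier G" "z \<in> K #> x" "z \<in> K #> y"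
  shows "K #> x = K #> y"
  using assms by (metis repr_independence)

text \<open>
  A coset \<open>H #> u\<close> in \<open>L\<close> with a chosen representative \<open>r\<close> is cut into the cosets \<open>(K #> h) #> r\<close>
  of \<open>K\<close>, one for each coset \<open>K #> h\<close> in \<open>H\<close>. This gives a bijection between pairs of cosets and
  cosets of \<open>K\<close> in \<open>L\<close>. Because the cardinality of a product is the product of the cardinalities
  also under the convention that infinite sets have cardinality 0, the formula covers infinite
  indices.
\<close>

lemma subgroup_index_mult:
  assumes K: "subgroup K G" and H: "subgroup H G" and L: "subgroup L G"
    and KH: "K \<subseteq> H" and HL: "H \<subseteq> L"
  shows "subgroup_index G L K = subgroup_index G L H * subgroup_index G H K"
proof -
  have Lc: "L \<subseteq> carrier G" and Hc: "H \<subseteq> carrier G" and Kc: "K \<subseteq> carrier G"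
    using assms by (auto dest: subgroup.subset)
  let ?A = "(\<lambda>x. K #> x) ` H" and ?B = "(\<lambda>x. H #> x) ` L" and ?C = "(\<lambda>x. K #> x) ` L"
  define rep where "rep C = (SOME x. x \<in> C)" for C :: "'a set"
  have rep: "rep C \<in> C \<and> rep C \<in> L \<and> H #> rep C = C" if C: "C \<in> ?B" for C
  proof -
    obtain x where x: "x \<in> L" "C = H #> x" using C by blast
    then have "x \<in> C" using rcos_self H Lc by auto
    then have r: "rep C \<in> C" unfolding rep_def by (rule someI)
    moreover have "C \<subseteq> L" using x r_coset_subset_subgroup[OF L HL] by auto
    ultimately show ?thesis using x repr_independence[OF _ _ H, of "rep C" x] Lc by auto
  qed
  define f where "f = (\<lambda>(C, D). D #> rep C)"
  have f_eq: "f (C, K #> y) = K #> (y \<otimes> rep C)" if "C \<in> ?B" "y \<in> H" for C y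
  proof -
    have "rep C \<in> carrier G" "y \<in> carrier G" using rep[OF that(1)] that(2) Lc Hc by auto
    then show ?thesis by (simp add: f_def coset_mult_assoc[OF Kc])
  qed
  have "bij_betw f (?B \<times> ?A) ?C"
  proof (rule bij_betw_imageI)
    show "inj_on f (?B \<times> ?A)"
    proof (rule inj_onI, clarify)
      fix u v x y
      assume uv: "u \<in> L" "v \<in> L" and xy: "x \<in> H" "y \<in> H"
        and eq: "f (H #> u, K #> x) = f (H #> v, K #> y)"
      let ?u = "rep (H #> u)" and ?v = "rep (H #> v)"
      have u: "?u \<in> L" "H #> ?u = H #> u" and v: "?v \<in> L" "H #> ?v = H #> v"
        using rep[OF imageI[OF uv(1)]] rep[OF imageI[OF uv(2)]] by auto
      have eq': "(K #> x) #> ?u = (K #> y) #> ?v" using eq by (simp add: f_def)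
      have "x \<in> K #> x" using rcos_self K xy Hc by auto
      then have z: "x \<otimes> ?u \<in> (K #> x) #> ?u" unfolding r_coset_def[of _ "K #> x"] by blast
      have "K #> x \<subseteq> H" "K #> y \<subseteq> H" using r_coset_subset_subgroup[OF H KH] xy by auto
      then have "(K #> x) #> ?u \<subseteq> H #> ?u" "(K #> y) #> ?v \<subseteq> H #> ?v"
        by (simp_all add: r_coset_mono)
      moreover have "?u \<in> carrier G" "?v \<in> carrier G" using u v Lc by auto
      ultimately have "H #> ?u = H #> ?v" using z eq' r_coset_eqI[OF H] by blast
      then have uv': "H #> u = H #> v" using u v by simp
      then have "((K #> x) #> ?u) #> inv ?u = ((K #> y) #> ?u) #> inv ?u" using eq' by simp
      moreover have "K #> x \<subseteq> carrier G" "K #> y \<subseteq> carrier G"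
        using r_coset_subset_G[OF Kc] xy Hc by blast+
      moreover have "?u \<in> carrier G" using u Lc by blast
      ultimately have "K #> x = K #> y" by (simp add: coset_mult_assoc)
      with uv' show "H #> u = H #> v \<and> K #> x = K #> y" by blast
    qed
    show "f ` (?B \<times> ?A) = ?C"
    proof
      show "f ` (?B \<times> ?A) \<subseteq> ?C"
      proof clarify
        fix u x assume *: "u \<in> L" "x \<in> H"
        then have "f (H #> u, K #> x) = K #> (x \<otimes> rep (H #> u))" using f_eq by simp
        moreover have "x \<otimes> rep (H #> u) \<in> L"
          using * rep[OF imageI[OF *(1)]] HL by (intro subgroup.m_closed[OF L]) auto
        ultimately show "f (H #> u, K #> x) \<in> ?C" by blast
      qed
      show "?C \<subseteq> f ` (?B \<times> ?A)"
      proof clarify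
        fix w assume w: "w \<in> L"
        let ?r = "rep (H #> w)"
        have r: "?r \<in> L" "H #> ?r = H #> w" using rep[OF imageI[OF w]] by auto
        have "w \<in> H #> ?r" using rcos_self H w Lc r by auto
        then obtain h where h: "h \<in> H" "w = h \<otimes> ?r"
          unfolding r_coset_def[of _ H ?r] by blast
        have "f (H #> w, K #> h) = K #> w" using f_eq[OF imageI[OF w] h(1)] h(2) by simp
        moreover have "(H #> w, K #> h) \<in> ?B \<times> ?A" using w h by blast
        ultimately show "K #> w \<in> f ` (?B \<times> ?A)" by (metis imageI)
      qed
    qed
  qed
  then have "card (?B \<times> ?A) = card ?C" by (rule bij_betw_same_card)
  then show ?thesis by (simp add: subgroup_index_eq_card_image card_cartesian_product)
qed

text \<open>
  Each coset of \<open>H \<inter> K\<close> in \<open>H\<close> is the trace on \<open>H\<close> of a coset of \<open>K\<close> in \<open>L\<close>. Finiteness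
  matters: if the right-hand side were an infinite index, its value would be 0.
\<close>

lemma subgroup_index_Int_le:
  assumes H: "subgroup H G" and K: "subgroup K G" and HL: "H \<subseteq> L"
    and fin: "finite ((\<lambda>x. K #> x) ` L)"
  shows "subgroup_index G H (H \<inter> K) \<le> subgroup_index G L K"
proof -
  have eq: "(H \<inter> K) #> x = H \<inter> (K #> x)" if x: "x \<in> H" for x
  proof
    show "(H \<inter> K) #> x \<subseteq> H \<inter> (K #> x)"
      using x subgroup.m_closed[OF H] by (auto simp: r_coset_def)
    show "H \<inter> (K #> x) \<subseteq> (H \<inter> K) #> x"
    proof
      fix y assume "y \<in> H \<inter> (K #> x)"
      then obtain k where k: "k \<in> K" "y = k \<otimes> x" "y \<in> H" by (auto simp: r_coset_def)
      then have "k = y \<otimes> inv x"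
        using x H K by (metis inv_solve_right subgroup.mem_carrier)
      then have "k \<in> H" using k(3) x H by (metis subgroup.m_closed subgroup.m_inv_closed)
      with k show "y \<in> (H \<inter> K) #> x" by (auto simp: r_coset_def)
    qed
  qed
  have "(\<lambda>x. (H \<inter> K) #> x) ` H = (\<lambda>C. H \<inter> C) ` (\<lambda>x. K #> x) ` H"
    by (auto simp: eq image_image)
  moreover have "(\<lambda>x. K #> x) ` H \<subseteq> (\<lambda>x. K #> x) ` L" using HL by auto
  ultimately have "card ((\<lambda>x. (H \<inter> K) #> x) ` H) \<le> card ((\<lambda>x. K #> x) ` L)"
    using fin by (metis card_image_le card_mono finite_subset le_trans)
  then show ?thesis by (simp add: subgroup_index_eq_card_image)
qed

lemma subgroup_index_iso_image:
  assumes "\<phi> \<in> iso G G" and H: "H \<subseteq> carrier G" and K: "K \<subseteq> carrier G"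
  shows "subgroup_index G (\<phi> ` H) (\<phi> ` K) = subgroup_index G H K"
proof -
  have inj: "inj_on \<phi> (carrier G)" and hom: "\<phi> \<in> hom G G"
    using assms by (auto simp: iso_def bij_betw_def)
  have "\<phi> ` K #> \<phi> x = \<phi> ` (K #> x)" if "x \<in> H" for x
  proof -
    have "\<phi> (k \<otimes> x) = \<phi> k \<otimes> \<phi> x" if "k \<in> K" for k
      using that \<open>x \<in> H\<close> H K by (intro hom_mult[OF hom]) auto
    then show ?thesis by (simp add: r_coset_def image_UN)
  qed
  then have "(\<lambda>x. \<phi> ` K #> x) ` \<phi> ` H = (\<lambda>C. \<phi> ` C) ` (\<lambda>x. K #> x) ` H"
    by (auto simp: image_image)
  moreover have "inj_on (\<lambda>C. \<phi> ` C) ((\<lambda>x. K #> x) ` H)"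
    by (rule inj_on_subset[OF inj_on_image_Pow[OF inj]])
      (use H K r_coset_subset_G[OF K] in blast)
  ultimately show ?thesis
    by (simp add: subgroup_index_eq_card_image card_image)
qed

end

section \<open>Compact open subgroups\<close>

context topological_group
begin

lemma continuous_map_mult_compose:
  assumes "continuous_map X T f" "continuous_map X T g"
  shows "continuous_map X T (\<lambda>x. f x \<otimes> g x)"
proof -
  have "continuous_map X (prod_topology T T) (\<lambda>x. (f x, g x))"
    using assms by (simp add: continuous_map_paired)
  from continuous_map_compose[OF this continuous_map_mult] show ?thesis
    by (simp add: o_def)
qed

lemma openin_r_coset:
  assumes U: "openin T U" and x: "x \<in> carrier G"
  shows "openin T (U #> x)"
proof -
  have Uc: "U \<subseteq> carrier G" using openin_subset[OF U] topspace_eq_carrier by simp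
  have "continuous_map T T (\<lambda>y. y \<otimes> inv x)"
    using x by (intro continuous_map_mult_compose) (auto simp: topspace_eq_carrier)
  then have "openin T {y \<in> topspace T. y \<otimes> inv x \<in> U}"
    using U by (rule openin_continuous_map_preimage)
  moreover have "{y \<in> topspace T. y \<otimes> inv x \<in> U} = U #> x"
  proof -
    have "y = (y \<otimes> inv x) \<otimes> x" if "y \<in> carrier G" for y
      using that x by (simp add: m_assoc)
    moreover have "u \<otimes> x \<otimes> inv x = u" if "u \<in> U" for u
      using that Uc x by (auto simp: m_assoc)
    ultimately show ?thesis
      using Uc x by (fastforce simp: r_coset_def topspace_eq_carrier)
  qed
  ultimately show ?thesis by simp
qed

text \<open>
  The cosets cover the compact set \<open>H\<close> by open sets and are pairwise equal or disjoint,
  so a finite subcover already contains all of them.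
\<close>

lemma finite_cosets_of_open_in_compact:
  assumes K: "subgroup K G" "openin T K" and H: "subgroup H G" "compactin T H"
  shows "finite ((\<lambda>x. K #> x) ` H)"
proof -
  have Hc: "H \<subseteq> carrier G" using H by (auto dest: subgroup.subset)
  let ?\<C> = "(\<lambda>x. K #> x) ` H"
  have "H \<subseteq> \<Union> ?\<C>" using rcos_self K Hc by blast
  moreover have "openin T C" if "C \<in> ?\<C>" for C
    using that openin_r_coset[OF K(2)] Hc by auto
  ultimately have "\<exists>\<F>. finite \<F> \<and> \<F> \<subseteq> ?\<C> \<and> H \<subseteq> \<Union> \<F>"
    by (intro compactinD[OF H(2)])
  then obtain \<F> where \<F>: "finite \<F>" "\<F> \<subseteq> ?\<C>" "H \<subseteq> \<Union> \<F>"
    by blast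
  have "?\<C> \<subseteq> \<F>"
  proof clarify
    fix x assume x: "x \<in> H"
    then obtain C where C: "x \<in> C" "C \<in> \<F>" using \<F>(3) by blast
    then obtain y where y: "y \<in> H" "C = K #> y" using \<F>(2) by blast
    then have "K #> x = K #> y" using repr_independence[OF _ _ K(1), of x y] C Hc by auto
    with C y show "K #> x \<in> \<F>" by simp
  qed
  with \<F> show ?thesis by (metis finite_subset)
qed

lemma subgroup_index_pos:
  assumes "U \<in> compact_open_subgroups G T" "V \<in> compact_open_subgroups G T"
  shows "subgroup_index G U V > 0"
proof -
  have "U \<noteq> {}" using assms by (auto simp: compact_open_subgroups_def dest: subgroup.one_closed)
  then show ?thesis using assms finite_cosets_of_open_in_compact[of V U]
    by (auto simp: compact_open_subgroups_def subgroup_index_eq_card_image card_gt_0_iff)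
qed

text \<open>The diagonal is the preimage of the identity under \<open>(x, y) \<mapsto> x y\<^sup>-\<^sup>1\<close>.\<close>

lemma Hausdorff_if_one_closed:
  assumes "closedin T {\<one>}"
  shows "Hausdorff_space T"
proof -
  let ?d = "\<lambda>p. fst p \<otimes> inv (snd p)"
  have "continuous_map (prod_topology T T) T (\<lambda>p. inv (snd p))"
    using continuous_map_compose[OF continuous_map_snd continuous_map_inv] by (simp add: o_def)
  then have "continuous_map (prod_topology T T) T ?d"
    by (rule continuous_map_mult_compose[OF continuous_map_fst])
  then have "closedin (prod_topology T T) {p \<in> topspace (prod_topology T T). ?d p \<in> {\<one>}}"
    using assms by (rule closedin_continuous_map_preimage)
  moreover have "{p \<in> topspace (prod_topology T T). ?d p \<in> {\<one>}} = (\<lambda>x. (x, x)) ` topspace T"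
  proof -
    have "x \<otimes> inv y = \<one> \<longleftrightarrow> x = y" if "x \<in> carrier G" "y \<in> carrier G" for x y
      using that inv_equality[of x "inv y"] by auto
    then show ?thesis by (auto simp: topspace_eq_carrier)
  qed
  ultimately show ?thesis
    by (simp add: Hausdorff_space_closedin_diagonal)
qed

text \<open>
  The subgroup lies in \<open>C\<close> because \<open>\<one> \<in> C\<close>. The condition \<open>C #> g \<subseteq> C\<close> on \<open>g\<close> is closed, being an
  intersection over \<open>c \<in> C\<close> of preimages of the closed set \<open>C\<close>. It is also open: the \<open>g\<close> that
  violate it form the projection of the closed set of all \<open>(c, g)\<close> with \<open>c \<in> C\<close> and \<open>c g \<notin> C\<close>,
  and projection along a compact factor is a closed map. Continuity of inversion carries both
  properties over to the condition on \<open>inv g\<close>.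
\<close>

lemma stabilizer_of_clopen_compact:
  assumes C: "compactin T C" "openin T C" "closedin T C" and one: "\<one> \<in> C"
  shows "{g \<in> carrier G. C #> g \<subseteq> C \<and> C #> inv g \<subseteq> C} \<in> compact_open_subgroups G T"
    (is "?H \<in> _")
proof -
  have Cc: "C \<subseteq> carrier G" using openin_subset[OF C(2)] topspace_eq_carrier by simp
  let ?S = "{g \<in> carrier G. C #> g \<subseteq> C}"
  have S: "?S = {g \<in> topspace T. \<forall>c\<in>C. c \<otimes> g \<in> C}"
    by (auto simp: r_coset_def topspace_eq_carrier)
  have H: "?H = ?S \<inter> {g \<in> topspace T. inv g \<in> ?S}"
    by (auto simp: topspace_eq_carrier)
  have "subgroup ?H G"
  proof
    show "\<one> \<in> ?H" using Cc by simp
    fix g h assume gh: "g \<in> ?H" "h \<in> ?H"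
    have "C #> (g \<otimes> h) = (C #> g) #> h" "C #> inv (g \<otimes> h) = (C #> inv h) #> inv g"
      using gh Cc by (auto simp: coset_mult_assoc inv_mult_group)
    moreover have "(C #> g) #> h \<subseteq> C #> h" "(C #> inv h) #> inv g \<subseteq> C #> inv g"
      using gh by (auto simp: r_coset_def)
    ultimately show "g \<otimes> h \<in> ?H" using gh by auto
  qed auto
  moreover have "?H \<subseteq> C"
    using one by (force simp: r_coset_def)
  moreover have "closedin T ?H"
  proof -
    have cl: "closedin T {g \<in> topspace T. c \<otimes> g \<in> C}" if "c \<in> C" for c
      by (rule closedin_continuous_map_preimage[OF _ C(3)],
          rule continuous_map_mult_compose) (use that Cc in \<open>auto simp: topspace_eq_carrier\<close>)
    have "?S = (\<Inter>c\<in>C. {g \<in> topspace T. c \<otimes> g \<in> C})" using one unfolding S by auto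
    moreover have "closedin T \<dots>" using one cl by (intro closedin_INT) auto
    ultimately have "closedin T ?S" by simp
    then show ?thesis unfolding H
      using closedin_continuous_map_preimage[OF continuous_map_inv] by blast
  qed
  moreover have "openin T ?H"
  proof -
    let ?X = "prod_topology (subtopology T C) T"
    have "continuous_map ?X T (\<lambda>p. fst p \<otimes> snd p)"
      by (rule continuous_map_mult_compose[OF
            continuous_map_into_fulltopology[OF continuous_map_fst] continuous_map_snd])
    then have "closedin ?X {p \<in> topspace ?X. fst p \<otimes> snd p \<in> topspace T - C}"
      using C(2) by (intro closedin_continuous_map_preimage) auto
    moreover have "closed_map ?X T snd"
      by (intro closed_map_snd compact_space_subtopology C)
    ultimately have "closedin T (snd ` {p \<in> topspace ?X. fst p \<otimes> snd p \<in> topspace T - C})"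
      by (simp add: closed_map_def)
    moreover have "?S = topspace T - snd ` {p \<in> topspace ?X. fst p \<otimes> snd p \<in> topspace T - C}"
      using Cc unfolding S by (force simp: topspace_eq_carrier image_iff)
    ultimately have "openin T ?S" by auto
    then show ?thesis unfolding H
      using openin_continuous_map_preimage[OF continuous_map_inv] by blast
  qed
  ultimately show ?thesis
    using closed_compactin[OF C(1)] by (simp add: compact_open_subgroups_def)
qed

end

context tdlc_group
begin

lemma Hausdorff: "Hausdorff_space T"
  using totally_disconnected[OF one_closed] closedin_connected_component_of[of T \<one>]
  by (intro Hausdorff_if_one_closed) simp

text \<open>
  In a locally compact Hausdorff space a compact component, here \<open>{\<one>}\<close>, has a clopen
  neighbourhood inside any given neighbourhood. Choosing the latter inside a compact set makes the
  clopen neighbourhood compact.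
\<close>

theorem van_Dantzig: "compact_open_subgroups G T \<noteq> {}"
proof -
  have one: "\<one> \<in> topspace T" by (simp add: topspace_eq_carrier)
  then obtain W K where W: "openin T W" "compactin T K" "\<one> \<in> W" "W \<subseteq> K"
    using locally_compact unfolding locally_compact_space_def by blast
  have "{\<one>} \<in> connected_components_of T"
    using totally_disconnected[OF one_closed] connected_component_in_connected_components_of one
    by metis
  then obtain C D where CD: "openin T C" "openin T D" "disjnt C D" "C \<union> D = topspace T"
      "{\<one>} \<subseteq> C" "C \<subseteq> W"
    by (rule wilder_locally_compact_component_thm[OF locally_compact Hausdorff])
      (use W one in auto)
  have "C = topspace T - D" using CD by (auto simp: disjnt_iff)
  then have "closedin T C" using CD by auto
  moreover from this have "compactin T C"
    using closed_compactin[OF W(2)] CD W by blast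
  ultimately show ?thesis
    using stabilizer_of_clopen_compact[of C] CD by auto
qed

lemma compact_open_subgroups_Int:
  assumes "U \<in> compact_open_subgroups G T" "V \<in> compact_open_subgroups G T"
  shows "U \<inter> V \<in> compact_open_subgroups G T"
proof -
  have "closedin T U"
    using assms Hausdorff by (auto simp: compact_open_subgroups_def intro: compactin_imp_closedin)
  then show ?thesis
    using assms subgroups_Inter_pair
    by (auto simp: compact_open_subgroups_def intro: closed_Int_compactin)
qed

lemma compact_open_subgroups_image:
  assumes "topological_automorphism G T \<phi>" "U \<in> compact_open_subgroups G T"
  shows "\<phi> ` U \<in> compact_open_subgroups G T"
proof -
  have U: "subgroup U G" "compactin T U" "openin T U"
    using assms by (auto simp: compact_open_subgroups_def)
  have "group_hom G G \<phi>"
    using assms(1) by (auto simp: topological_automorphism_def iso_def group_hom_def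
        group_hom_axioms_def is_group)
  from group_hom.subgroup_img_is_subgroup[OF this U(1)] have "subgroup (\<phi> ` U) G" .
  moreover have "homeomorphic_map T T \<phi>"
    using assms(1) by (simp add: topological_automorphism_def)
  ultimately show ?thesis
    using U openin_subset[OF U(3)] homeomorphic_map_openness[of T T \<phi> U]
      homeomorphic_map_compactness[of T T \<phi> U] by (simp add: compact_open_subgroups_def)
qed

end

lemma (in topological_group) topological_automorphism_inv_into:
  assumes "topological_automorphism G T \<phi>"
  shows "topological_automorphism G T (inv_into (carrier G) \<phi>)"
proof -
  have iso: "\<phi> \<in> iso G G" and hom: "homeomorphic_map T T \<phi>"
    using assms by (auto simp: topological_automorphism_def)
  obtain g where g: "homeomorphic_maps T T \<phi> g"
    using hom by (auto simp: homeomorphic_map_maps)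
  have "g x = inv_into (carrier G) \<phi> x" if "x \<in> topspace T" for x
  proof -
    have "g x \<in> carrier G" "\<phi> (g x) = x"
      using g that by (auto simp: homeomorphic_maps_def continuous_map_def topspace_eq_carrier)
    moreover have "inj_on \<phi> (carrier G)"
      using iso by (simp add: iso_def bij_betw_def)
    ultimately show ?thesis
      by (simp add: inv_into_f_eq)
  qed
  moreover have "homeomorphic_map T T g"
    using g by (auto simp: homeomorphic_maps_map)
  ultimately have "homeomorphic_map T T (inv_into (carrier G) \<phi>)"
    using homeomorphic_map_eq by blast
  then show ?thesis
    using iso_set_sym[OF iso] by (simp add: topological_automorphism_def)
qed

section \<open>The subgroups along a cotrajectory\<close>

text \<open>
  Describing the cotrajectory through forward orbits replaces the iterates of the inverse of
  \<open>\<phi>\<close> by powers of \<open>\<phi>\<close>, so that its identities become statements about shifting the index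
  \<open>j\<close>.
\<close>

lemma cotrajectory_iff:
  assumes bij: "bij_betw \<phi> (carrier G) (carrier G)" and U: "U \<subseteq> carrier G"
  shows "x \<in> cotrajectory G \<phi> U n \<longleftrightarrow> x \<in> carrier G \<and> (\<forall>j\<le>n. (\<phi> ^^ j) x \<in> U)"
proof -
  let ?\<psi> = "inv_into (carrier G) \<phi>"
  have \<phi>: "\<phi> y \<in> carrier G" "?\<psi> y \<in> carrier G" "?\<psi> (\<phi> y) = y" "\<phi> (?\<psi> y) = y"
    if "y \<in> carrier G" for y
    using bij that by (auto simp: bij_betw_def inv_into_into f_inv_into_f)
  have left: "(\<phi> ^^ j) ((?\<psi> ^^ j) y) = y \<and> (?\<psi> ^^ j) y \<in> carrier G"
    if "y \<in> carrier G" for j y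
    using that by (induction j arbitrary: y) (auto simp: funpow_swap1 \<phi>)
  have right: "(?\<psi> ^^ j) ((\<phi> ^^ j) y) = y" if "y \<in> carrier G" for j y
    using that by (induction j arbitrary: y) (auto simp: funpow_swap1 \<phi>)
  have mem: "y \<in> (?\<psi> ^^ j) ` U \<longleftrightarrow> y \<in> carrier G \<and> (\<phi> ^^ j) y \<in> U" for y j
  proof
    assume "y \<in> (?\<psi> ^^ j) ` U"
    then obtain u where u: "u \<in> U" "y = (?\<psi> ^^ j) u" by blast
    then show "y \<in> carrier G \<and> (\<phi> ^^ j) y \<in> U" using left[of u j] U by auto
  next
    assume "y \<in> carrier G \<and> (\<phi> ^^ j) y \<in> U"
    then show "y \<in> (?\<psi> ^^ j) ` U" using right[of y j] by (metis imageI)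
  qed
  have "{- int n..0} = (\<lambda>j. - int j) ` {..n}"
  proof
    show "{- int n..0} \<subseteq> (\<lambda>j. - int j) ` {..n}"
    proof
      fix k assume "k \<in> {- int n..0}"
      then have "k = - int (nat (- k))" "nat (- k) \<in> {..n}" by auto
      then show "k \<in> (\<lambda>j. - int j) ` {..n}" by blast
    qed
  qed auto
  moreover have "iterate G \<phi> (- int j) = ?\<psi> ^^ j" for j
    by (simp add: iterate_def)
  ultimately have "cotrajectory G \<phi> U n = (\<Inter>j\<le>n. (?\<psi> ^^ j) ` U)"
    by (simp add: cotrajectory_def image_image)
  then show ?thesis
    using mem by auto
qed

lemma
  assumes "bij_betw \<phi> (carrier G) (carrier G)" "U \<subseteq> carrier G"
  shows cotrajectory_0: "cotrajectory G \<phi> U 0 = U"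
    and cotrajectory_Suc:
      "cotrajectory G \<phi> U (Suc n) = U \<inter> inv_into (carrier G) \<phi> ` cotrajectory G \<phi> U n"
    and cotrajectory_subset: "cotrajectory G \<phi> U n \<subseteq> U"
    and cotrajectory_Suc_subset: "cotrajectory G \<phi> U (Suc n) \<subseteq> cotrajectory G \<phi> U n"
    and image_cotrajectory_Suc:
      "\<phi> ` cotrajectory G \<phi> U (Suc n) = cotrajectory G \<phi> U n \<inter> \<phi> ` cotrajectory G \<phi> U n"
proof -
  note iff = cotrajectory_iff[OF assms]
  have \<phi>: "\<phi> y \<in> carrier G" "inv_into (carrier G) \<phi> y \<in> carrier G"
      "inv_into (carrier G) \<phi> (\<phi> y) = y" "\<phi> (inv_into (carrier G) \<phi> y) = y"
    if "y \<in> carrier G" for y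
    using assms(1) that by (auto simp: bij_betw_def inv_into_into f_inv_into_f)
  have step: "x \<in> cotrajectory G \<phi> U (Suc n) \<longleftrightarrow> x \<in> U \<and> \<phi> x \<in> cotrajectory G \<phi> U n" for x n
  proof -
    have "(\<forall>j\<le>Suc n. (\<phi> ^^ j) x \<in> U) \<longleftrightarrow> x \<in> U \<and> (\<forall>j\<le>n. (\<phi> ^^ j) (\<phi> x) \<in> U)"
      by (auto simp: All_less_Suc2 funpow_swap1 simp flip: less_Suc_eq_le)
    then show ?thesis using \<phi> assms(2) by (auto simp: iff)
  qed
  show "cotrajectory G \<phi> U 0 = U"
    using assms(2) by (auto simp: iff)
  have c: "cotrajectory G \<phi> U n \<subseteq> carrier G" for n by (auto simp: iff)
  show "cotrajectory G \<phi> U (Suc n) = U \<inter> inv_into (carrier G) \<phi> ` cotrajectory G \<phi> U n"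
  proof
    show "cotrajectory G \<phi> U (Suc n) \<subseteq> U \<inter> inv_into (carrier G) \<phi> ` cotrajectory G \<phi> U n"
    proof
      fix x assume "x \<in> cotrajectory G \<phi> U (Suc n)"
      then have x: "x \<in> U" "\<phi> x \<in> cotrajectory G \<phi> U n" by (auto simp: step)
      then have "x = inv_into (carrier G) \<phi> (\<phi> x)" using \<phi> assms(2) by auto
      with x show "x \<in> U \<inter> inv_into (carrier G) \<phi> ` cotrajectory G \<phi> U n" by blast
    qed
    show "U \<inter> inv_into (carrier G) \<phi> ` cotrajectory G \<phi> U n \<subseteq> cotrajectory G \<phi> U (Suc n)"
      using c \<phi> by (auto simp: step subset_iff)
  qed
  show sub: "cotrajectory G \<phi> U (Suc n) \<subseteq> cotrajectory G \<phi> U n"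
    by (auto simp: iff)
  show "cotrajectory G \<phi> U n \<subseteq> U"
  proof
    fix x assume "x \<in> cotrajectory G \<phi> U n"
    then have "(\<phi> ^^ 0) x \<in> U" unfolding iff by blast
    then show "x \<in> U" by simp
  qed
  then show "\<phi> ` cotrajectory G \<phi> U (Suc n) = cotrajectory G \<phi> U n \<inter> \<phi> ` cotrajectory G \<phi> U n"
    using sub by (auto simp: step)
qed

context tdlc_group
begin

context
  fixes \<phi> U
  assumes aut: "topological_automorphism G T \<phi>" and U: "U \<in> compact_open_subgroups G T"
begin

lemma automorphism_bij: "bij_betw \<phi> (carrier G) (carrier G)"
  using aut by (simp add: topological_automorphism_def iso_def)

lemma compact_open_subset_carrier: "U \<subseteq> carrier G"
  using U by (auto simp: compact_open_subgroups_def dest: subgroup.subset)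

lemmas cotrajectory_simps =
  cotrajectory_0[OF automorphism_bij compact_open_subset_carrier]
  cotrajectory_Suc[OF automorphism_bij compact_open_subset_carrier]
  cotrajectory_Suc_subset[OF automorphism_bij compact_open_subset_carrier]
  image_cotrajectory_Suc[OF automorphism_bij compact_open_subset_carrier]

lemma cotrajectory_compact_open: "cotrajectory G \<phi> U n \<in> compact_open_subgroups G T"
proof (induction n)
  case 0
  then show ?case using U by (simp add: cotrajectory_simps)
next
  case (Suc n)
  then show ?case
    unfolding cotrajectory_simps(2) using U topological_automorphism_inv_into[OF aut]
    by (intro compact_open_subgroups_Int compact_open_subgroups_image)
qed

abbreviation step_index :: "nat \<Rightarrow> nat" where
  "step_index n \<equiv> subgroup_index G (cotrajectory G \<phi> U n) (cotrajectory G \<phi> U (Suc n))"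

lemma step_index_image:
  "step_index n = subgroup_index G (\<phi> ` cotrajectory G \<phi> U n) (\<phi> ` cotrajectory G \<phi> U (Suc n))"
  using aut cotrajectory_compact_open
  by (intro subgroup_index_iso_image[symmetric])
    (auto simp: topological_automorphism_def compact_open_subgroups_def dest: subgroup.subset)

text \<open>
  After transport along \<open>\<phi>\<close> the smaller group is \<open>\<phi> (V (n+1)) = V n \<inter> \<phi> (V n)\<close>, which is
  exactly the group in the definition of the scale at \<open>V n\<close>.
\<close>

lemma step_index_eq_scale_at: "step_index n = scale_at G \<phi> (cotrajectory G \<phi> U n)"
  unfolding scale_at_def step_index_image cotrajectory_simps(4) ..

lemma scale_le_step_index: "scale G T \<phi> \<le> step_index n"
  unfolding step_index_eq_scale_at scale_def
  using cotrajectory_compact_open by (intro cINF_lower) auto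

text \<open>
  After transport along \<open>\<phi>\<close> the index on the left is \<open>[H : H \<inter> K]\<close> with \<open>H = \<phi> (V (n+1))\<close> and
  \<open>K = V (n+1)\<close>. Both groups lie in \<open>V n\<close>, and \<open>[V n : K]\<close> is the index on the right.
\<close>

lemma step_index_Suc_le: "step_index (Suc n) \<le> step_index n"
proof -
  let ?V = "cotrajectory G \<phi> U n" and ?V' = "cotrajectory G \<phi> U (Suc n)"
  have "step_index (Suc n) = subgroup_index G (\<phi> ` ?V') (\<phi> ` ?V' \<inter> ?V')"
    unfolding step_index_image[of "Suc n"] cotrajectory_simps(4)[of "Suc n"] by (simp add: Int_commute)
  also have "\<dots> \<le> subgroup_index G ?V ?V'"
  proof (rule subgroup_index_Int_le)
    show "finite ((\<lambda>x. ?V' #> x) ` ?V)"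
      using cotrajectory_compact_open
      by (intro finite_cosets_of_open_in_compact) (auto simp: compact_open_subgroups_def)
    show "\<phi> ` ?V' \<subseteq> ?V" unfolding cotrajectory_simps(4) by blast
  qed (use compact_open_subgroups_image[OF aut cotrajectory_compact_open] cotrajectory_compact_open
      in \<open>auto simp: compact_open_subgroups_def\<close>)
  finally show ?thesis .
qed

lemma index_cotrajectory_Suc:
  "subgroup_index G U (cotrajectory G \<phi> U (Suc n)) =
     subgroup_index G U (cotrajectory G \<phi> U n) * step_index n"
proof -
  have V: "subgroup (cotrajectory G \<phi> U k) G" for k
    using cotrajectory_compact_open[of k] by (simp add: compact_open_subgroups_def)
  have "subgroup U G" using U by (simp add: compact_open_subgroups_def)
  then show ?thesis
    by (rule subgroup_index_mult[OF V V _ cotrajectory_simps(3)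
          cotrajectory_subset[OF automorphism_bij compact_open_subset_carrier]])
qed

end

end

lemma antimono_nat_eventually_const:
  fixes a :: "nat \<Rightarrow> nat"
  assumes "\<And>n. a (Suc n) \<le> a n"
  obtains N where "\<And>n. n \<ge> N \<Longrightarrow> a n = a N"
proof -
  obtain N where N: "\<And>n. a N \<le> a n"
    using ex_has_least_nat[of "\<lambda>_. True" 0 a] by auto
  show thesis
  proof (rule that)
    show "a n = a N" if "n \<ge> N" for n
      using lift_Suc_antimono_le[of a, OF assms that] N by (rule le_antisym)
  qed
qed

text \<open>From \<open>N\<close> on, \<open>ln (a n)\<close> is an affine function of \<open>n\<close> with slope \<open>ln c\<close>.\<close>

lemma ln_eventually_geometric_over_n_tendsto:
  fixes a :: "nat \<Rightarrow> nat"
  assumes pos: "a N > 0" "c > 0" and step: "\<And>n. n \<ge> N \<Longrightarrow> a (Suc n) = a n * c"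
  shows "(\<lambda>n. ln (real (a n)) / real n) \<longlonglongrightarrow> ln (real c)"
proof -
  have a: "a n = a N * c ^ (n - N)" if "n \<ge> N" for n
    using that by (induction n rule: dec_induct) (auto simp: step Suc_diff_le)
  have ev: "eventually (\<lambda>n. (ln (real (a N)) + (real n - real N) * ln (real c)) / real n
      = ln (real (a n)) / real n) sequentially"
    using eventually_ge_at_top[of N]
  proof eventually_elim
    case (elim n)
    then show ?case
      using pos by (simp add: a[OF elim] ln_mult ln_realpow of_nat_diff)
  qed
  have "(\<lambda>n. (ln (real (a N)) + (real n - real N) * ln (real c)) / real n)
      \<longlonglongrightarrow> ln (real c)"
    by real_asymp
  from Lim_transform_eventually[OF this ev] show ?thesis .
qed

section \<open>Scale and entropy\<close>

lemma (in tdlc_group) ln_scale_le_H_top: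
  assumes aut: "topological_automorphism G T \<phi>" and U: "U \<in> compact_open_subgroups G T"
  shows "ln (real (scale G T \<phi>)) \<le> H_top G \<phi> U"
proof -
  let ?V = "cotrajectory G \<phi> U"
  let ?\<alpha> = "step_index \<phi> U"
  obtain N where N: "\<And>n. n \<ge> N \<Longrightarrow> ?\<alpha> n = ?\<alpha> N"
    using antimono_nat_eventually_const[of ?\<alpha>] step_index_Suc_le[OF assms] by blast
  have pos: "?\<alpha> N > 0" "subgroup_index G U (?V N) > 0"
    using subgroup_index_pos cotrajectory_compact_open[OF assms] U by auto
  have "(\<lambda>n. ln (real (subgroup_index G U (?V n))) / real n) \<longlonglongrightarrow> ln (real (?\<alpha> N))"
  proof (rule ln_eventually_geometric_over_n_tendsto)
    show "subgroup_index G U (?V (Suc n)) = subgroup_index G U (?V n) * ?\<alpha> N" if "n \<ge> N" for n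
      unfolding index_cotrajectory_Suc[OF assms] N[OF that] ..
  qed (fact pos)+
  then have "H_top G \<phi> U = ln (real (?\<alpha> N))"
    unfolding H_top_def by (rule limI)
  moreover have "scale G T \<phi> \<le> ?\<alpha> N"
    by (rule scale_le_step_index[OF assms])
  \<comment> \<open>The case of a vanishing scale is settled by the convention \<open>ln 0 = 0\<close>.\<close>
  ultimately show ?thesis
    using pos by (cases "scale G T \<phi> = 0") auto
qed

theorem theorem3p1:
  fixes G :: "('a, 'b) monoid_scheme" and T :: "'a topology" and \<phi> :: "'a \<Rightarrow> 'a"
  assumes "tdlc_group G T"
    and "topological_automorphism G T \<phi>"
  shows "ereal (ln (real (scale G T \<phi>))) \<le> h_top G T \<phi>"
proof -
  interpret tdlc_group G T by fact
  obtain U where U: "U \<in> compact_open_subgroups G T"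
    using van_Dantzig by blast
  have "ereal (ln (real (scale G T \<phi>))) \<le> ereal (H_top G \<phi> U)"
    using ln_scale_le_H_top[OF assms(2) U] by simp
  also have "\<dots> \<le> h_top G T \<phi>"
    unfolding h_top_def using U by (rule SUP_upper)
  finally show ?thesis .
qed

end
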